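(* Let $(M,g)$ be a compact Riemannian surface without boundary and let $\gamma$ be a closed embedded geodesic of $(M,g)$. Suppose there is a non-degenerate Bouncing Jacobi Field $\Phi$ with $n$ minimums for the geodesic $\gamma$. Then $2n\ge\mathrm{Ind}(\gamma)$.
   Context: $\gamma$, of length $|\gamma|$, is parameterized by arc-length $s$ and identified with $\mathbf R/|\gamma|\mathbf Z$. The Jacobi operator is $\mathfrak J_\gamma:=-(\partial_s^2+K_g)$, with $K_g$ the Gauss curvature along $\gamma$. $\mathrm{Ind}(\gamma)$ is the maximal dimension of a space of smooth functions on $\gamma$ over which $\int_\gamma(|\partial_sv|^2-K_gv^2)\,ds$ is negative definite. $f(s_j^+)$ and $f(s_j^-)$ denote the limits of $f$ at $s_j$ from the right and from the left. Bouncing Jacobi Field with $n\ge1$ minimums: a function $\Phi:\gamma\to\mathbf R$ for which there exist $n$ distinct points $s_1,\dots,s_n\in\gamma$ such that $\Phi$ is continuous on $\gamma$, smooth on $\gamma-\{s_1,\dots,s_n\}$, $\mathfrak J_\gamma\Phi=0$ and $\Phi>1$ on $\gamma-\{s_1,\dots,s_n\}$, and $\Phi(s_j)=1$, $\partial_s\Phi(s_j^+)=-\partial_s\Phi(s_j^-)>0$ for all $j$. With $N_j:=\partial_s\Phi(s_j^+)-\partial_s\Phi(s_j^-)$, $\Phi$ is non-degenerate if the following system has no non-trivial solution $\eta:\gamma-\{s_1,\dots,s_n\}\to\mathbf R$: $\mathfrak J_\gamma\eta=0$ in $\gamma-\{s_1,\dots,s_n\}$ and, for all $j=1,\dots,n$,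 $\eta(s_j^+)+\eta(s_j^-)=0$ and $\partial_s\eta(s_j^+)+\partial_s\eta(s_j^-)+2K_g(s_j)\frac{\eta(s_j^+)-\eta(s_j^-)}{N_j}=0$. *)

theory Defs
  imports "HOL-Analysis.Analysis" "HOL-Library.Function_Algebras"
begin

section \<open>Smooth functions\<close>

text \<open>The set \<open>U\<close> is always meant to be open.\<close>

fun times_differentiable_on ::
  "nat \<Rightarrow> 'a::real_normed_vector set \<Rightarrow> ('a \<Rightarrow> 'b::real_normed_vector) \<Rightarrow> bool" where
  "times_differentiable_on 0 U f \<longleftrightarrow> continuous_on U f"
| "times_differentiable_on (Suc k) U f \<longleftrightarrow>
     (\<forall>x\<in>U. f differentiable (at x)) \<and>
     (\<forall>v. times_differentiable_on k U (\<lambda>x. frechet_derivative f (at x) v))"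

definition smooth_on :: "'a::real_normed_vector set \<Rightarrow> ('a \<Rightarrow> 'b::real_normed_vector) \<Rightarrow> bool" where
  "smooth_on U f \<longleftrightarrow> (\<forall>k. times_differentiable_on k U f)"


section \<open>Riemannian surfaces\<close>

text \<open>A chart is a pair of its domain and its coordinate map. A metric assigns to each chart the
  matrix of its components \<open>g\<^sub>i\<^sub>j\<close>, as a function of the coordinates. Charts take values in open
  subsets of the plane, so surfaces have no boundary.\<close>

type_synonym 'a chart = "'a set \<times> ('a \<Rightarrow> real^2)"
type_synonym 'a metric = "'a chart \<Rightarrow> real^2 \<Rightarrow> real^2^2"

definition chart_on :: "'a topology \<Rightarrow> 'a chart \<Rightarrow> bool" where
  "chart_on M c \<longleftrightarrow> openin M (fst c) \<and> open (snd c ` fst c) \<and>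
     homeomorphic_map (subtopology M (fst c)) (top_of_set (snd c ` fst c)) (snd c)"

definition transition :: "'a chart \<Rightarrow> 'a chart \<Rightarrow> real^2 \<Rightarrow> real^2" where
  "transition c d = snd d \<circ> inv_into (fst c) (snd c)"

locale riemannian_surface =
  fixes M :: "'a topology" and A :: "'a chart set" and g :: "'a metric"
  assumes Hausdorff: "Hausdorff_space M"
    and second_countable: "second_countable M"
    and chart: "c \<in> A \<Longrightarrow> chart_on M c"
    and cover: "(\<Union>c\<in>A. fst c) = topspace M"
    and smooth_transition: "c \<in> A \<Longrightarrow> d \<in> A \<Longrightarrow>
      smooth_on (snd c ` (fst c \<inter> fst d)) (transition c d)"
    and smooth_metric: "c \<in> A \<Longrightarrow> smooth_on (snd c ` fst c) (g c)"
    and symmetric_metric: "c \<in> A \<Longrightarrow> x \<in> snd c ` fst c \<Longrightarrow> transpose (g c x) = g c x"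
    and positive_metric: "c \<in> A \<Longrightarrow> x \<in> snd c ` fst c \<Longrightarrow> v \<noteq> 0 \<Longrightarrow> v \<bullet> (g c x *v v) > 0"
    and compatible_metric: "c \<in> A \<Longrightarrow> d \<in> A \<Longrightarrow> x \<in> snd c ` (fst c \<inter> fst d) \<Longrightarrow>
      J = matrix (frechet_derivative (transition c d) (at x)) \<Longrightarrow>
      g c x = transpose J ** g d (transition c d x) ** J"

locale compact_riemannian_surface = riemannian_surface +
  assumes compact: "compact_space M"

definition partial :: "2 \<Rightarrow> (real^2 \<Rightarrow> real) \<Rightarrow> real^2 \<Rightarrow> real" where
  "partial i f x = frechet_derivative f (at x) (axis i 1)"

text \<open>\<open>christoffel G k i j\<close> is \<open>\<Gamma>\<^sup>k\<^sub>i\<^sub>j\<close> for the metric with components \<open>G\<close>, and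
  \<open>riemann G i j k l\<close> is the component of \<open>R(\<partial>\<^sub>i, \<partial>\<^sub>j)\<partial>\<^sub>k\<close> along \<open>\<partial>\<^sub>l\<close>, for
  \<open>R(X, Y) = \<nabla>\<^sub>X \<nabla>\<^sub>Y - \<nabla>\<^sub>Y \<nabla>\<^sub>X - \<nabla>\<^bsub>[X, Y]\<^esub>\<close>.\<close>

definition christoffel :: "(real^2 \<Rightarrow> real^2^2) \<Rightarrow> 2 \<Rightarrow> 2 \<Rightarrow> 2 \<Rightarrow> real^2 \<Rightarrow> real" where
  "christoffel G k i j x = (\<Sum>l\<in>UNIV. matrix_inv (G x) $ k $ l *
     (partial i (\<lambda>y. G y $ j $ l) x + partial j (\<lambda>y. G y $ i $ l) x
       - partial l (\<lambda>y. G y $ i $ j) x)) / 2"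

definition riemann :: "(real^2 \<Rightarrow> real^2^2) \<Rightarrow> 2 \<Rightarrow> 2 \<Rightarrow> 2 \<Rightarrow> 2 \<Rightarrow> real^2 \<Rightarrow> real" where
  "riemann G i j k l x =
     partial i (christoffel G l j k) x - partial j (christoffel G l i k) x
     + (\<Sum>m\<in>UNIV. christoffel G m j k x * christoffel G l i m x
                 - christoffel G m i k x * christoffel G l j m x)"

text \<open>The Gauss curvature is \<open>\<langle>R(\<partial>\<^sub>1, \<partial>\<^sub>2)\<partial>\<^sub>2, \<partial>\<^sub>1\<rangle> / det g\<close>; by the Theorema Egregium the
  value does not depend on the chart chosen around the point.\<close>

definition gauss_curvature_in_chart :: "(real^2 \<Rightarrow> real^2^2) \<Rightarrow> real^2 \<Rightarrow> real" where
  "gauss_curvature_in_chart G x = (\<Sum>l\<in>UNIV. G x $ 1 $ l * riemann G 1 2 2 l x) / det (G x)"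

definition gauss_curvature :: "'a chart set \<Rightarrow> 'a metric \<Rightarrow> 'a \<Rightarrow> real" where
  "gauss_curvature A g p =
     (let c = SOME c. c \<in> A \<and> p \<in> fst c in gauss_curvature_in_chart (g c) (snd c p))"


section \<open>Closed embedded geodesics\<close>

text \<open>A closed curve of length \<open>L\<close> is an \<open>L\<close>-periodic map on the real line, parameterized by
  arc length. For a unit speed closed curve, being embedded means being injective on a period.\<close>

definition periodic :: "real \<Rightarrow> (real \<Rightarrow> 'b) \<Rightarrow> bool" where
  "periodic L f \<longleftrightarrow> (\<forall>t. f (t + L) = f t)"

definition closed_embedded_geodesic ::
  "'a topology \<Rightarrow> 'a chart set \<Rightarrow> 'a metric \<Rightarrow> real \<Rightarrow> (real \<Rightarrow> 'a) \<Rightarrow> bool" where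
  "closed_embedded_geodesic M A g L \<gamma> \<longleftrightarrow>
     L > 0 \<and> periodic L \<gamma> \<and> inj_on \<gamma> {0..<L} \<and> continuous_map euclidean M \<gamma> \<and>
     (\<forall>c\<in>A. let x = snd c \<circ> \<gamma>;
               x' = (\<lambda>t. vector_derivative x (at t));
               x'' = (\<lambda>t. vector_derivative x' (at t))
       in smooth_on {t. \<gamma> t \<in> fst c} x \<and>
          (\<forall>t. \<gamma> t \<in> fst c \<longrightarrow>
             x' t \<bullet> (g c (x t) *v x' t) = 1 \<and>
             (\<forall>k. x'' t $ k +
                (\<Sum>i\<in>UNIV. \<Sum>j\<in>UNIV. christoffel (g c) k i j (x t) * x' t $ i * x' t $ j) = 0)))"


section \<open>The Jacobi operator and the index\<close>

text \<open>Functions on \<open>\<gamma>\<close> are \<open>L\<close>-periodic functions of the arc-length parameter, and \<open>K\<close> is the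
  Gauss curvature along \<open>\<gamma>\<close> as a function of this parameter.\<close>

definition jacobi_operator :: "(real \<Rightarrow> real) \<Rightarrow> (real \<Rightarrow> real) \<Rightarrow> real \<Rightarrow> real" where
  "jacobi_operator K v t = - (deriv (deriv v) t + K t * v t)"

definition index_form :: "real \<Rightarrow> (real \<Rightarrow> real) \<Rightarrow> (real \<Rightarrow> real) \<Rightarrow> real" where
  "index_form L K v = integral {0..L} (\<lambda>t. (deriv v t)\<^sup>2 - K t * (v t)\<^sup>2)"

abbreviation scale_fun :: "real \<Rightarrow> (real \<Rightarrow> real) \<Rightarrow> real \<Rightarrow> real" where
  "scale_fun c v \<equiv> (\<lambda>t. c * v t)"

lemma vector_space_scale_fun: "vector_space scale_fun"
  by unfold_locales (auto simp: algebra_simps)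

text \<open>The supremum over the finite-dimensional subspaces is taken in \<open>enat\<close>: it is the maximal
  dimension, and \<open>\<infinity>\<close> if the dimensions are unbounded. The restriction to finite dimension is
  needed because \<open>vector_space.dim\<close> is 0 for a space of infinite dimension.\<close>

definition morse_index :: "real \<Rightarrow> (real \<Rightarrow> real) \<Rightarrow> enat" where
  "morse_index L K = Sup {enat (vector_space.dim scale_fun V) | V.
     module.subspace scale_fun V \<and>
     (\<exists>B. finite B \<and> V \<subseteq> module.span scale_fun B) \<and>
     (\<forall>v\<in>V. periodic L v \<and> smooth_on UNIV v) \<and>
     (\<forall>v\<in>V. v \<noteq> 0 \<longrightarrow> index_form L K v < 0)}"

definition geodesic_index :: "'a chart set \<Rightarrow> 'a metric \<Rightarrow> real \<Rightarrow> (real \<Rightarrow> 'a) \<Rightarrow> enat" where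
  "geodesic_index A g L \<gamma> = morse_index L (gauss_curvature A g \<circ> \<gamma>)"


section \<open>Bouncing Jacobi fields\<close>

text \<open>Points of \<open>\<gamma>\<close> are represented in \<open>{0..<L}\<close>; the following set consists of all parameters
  of the points \<open>s 1, \<dots>, s n\<close>.\<close>

definition bounce_params :: "real \<Rightarrow> nat \<Rightarrow> (nat \<Rightarrow> real) \<Rightarrow> real set" where
  "bounce_params L n s = {s j + of_int k * L | j k. j \<in> {1..n}}"

definition bouncing_jacobi_field ::
  "real \<Rightarrow> (real \<Rightarrow> real) \<Rightarrow> nat \<Rightarrow> (nat \<Rightarrow> real) \<Rightarrow> (real \<Rightarrow> real) \<Rightarrow> bool" where
  "bouncing_jacobi_field L K n s \<Phi> \<longleftrightarrow>
     n \<ge> 1 \<and> s ` {1..n} \<subseteq> {0..<L} \<and> inj_on s {1..n} \<and>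
     periodic L \<Phi> \<and> continuous_on UNIV \<Phi> \<and> smooth_on (- bounce_params L n s) \<Phi> \<and>
     (\<forall>t\<in>- bounce_params L n s. jacobi_operator K \<Phi> t = 0 \<and> \<Phi> t > 1) \<and>
     (\<forall>j\<in>{1..n}. \<Phi> (s j) = 1 \<and>
        (\<exists>d>0. (deriv \<Phi> \<longlongrightarrow> d) (at_right (s j)) \<and> (deriv \<Phi> \<longlongrightarrow> - d) (at_left (s j))))"

definition derivative_jump :: "(real \<Rightarrow> real) \<Rightarrow> real \<Rightarrow> real" where
  "derivative_jump \<Phi> t = Lim (at_right t) (deriv \<Phi>) - Lim (at_left t) (deriv \<Phi>)"

text \<open>The values of \<open>\<eta>\<close> on \<open>bounce_params L n s\<close> are irrelevant, as \<open>\<eta>\<close> is a function on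
  the complement.\<close>

definition linearized_bounce_solution ::
  "real \<Rightarrow> (real \<Rightarrow> real) \<Rightarrow> nat \<Rightarrow> (nat \<Rightarrow> real) \<Rightarrow> (real \<Rightarrow> real) \<Rightarrow> (real \<Rightarrow> real) \<Rightarrow> bool" where
  "linearized_bounce_solution L K n s \<Phi> \<eta> \<longleftrightarrow>
     periodic L \<eta> \<and> smooth_on (- bounce_params L n s) \<eta> \<and>
     (\<forall>t\<in>- bounce_params L n s. jacobi_operator K \<eta> t = 0) \<and>
     (\<forall>j\<in>{1..n}. \<exists>a b a' b'.
        (\<eta> \<longlongrightarrow> a) (at_right (s j)) \<and> (\<eta> \<longlongrightarrow> b) (at_left (s j)) \<and>
        (deriv \<eta> \<longlongrightarrow> a') (at_right (s j)) \<and> (deriv \<eta> \<longlongrightarrow> b') (at_left (s j)) \<and>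
        a + b = 0 \<and>
        a' + b' + 2 * K (s j) * ((a - b) / derivative_jump \<Phi> (s j)) = 0)"

definition nondegenerate ::
  "real \<Rightarrow> (real \<Rightarrow> real) \<Rightarrow> nat \<Rightarrow> (nat \<Rightarrow> real) \<Rightarrow> (real \<Rightarrow> real) \<Rightarrow> bool" where
  "nondegenerate L K n s \<Phi> \<longleftrightarrow>
     (\<forall>\<eta>. linearized_bounce_solution L K n s \<Phi> \<eta> \<longrightarrow> (\<forall>t\<in>- bounce_params L n s. \<eta> t = 0))"

end

theory Submission
  imports Defs "HOL-Library.Periodic_Fun"
begin

text \<open>Off the bounce points \<open>\<Phi>\<close> is a positive Jacobi field, and completing the square gives
  \<open>v'\<^sup>2 - K v\<^sup>2 = (v' - v \<Phi>' / \<Phi>)\<^sup>2 + (v\<^sup>2 \<Phi>' / \<Phi>)'\<close>. If \<open>v\<close> vanishes at the bounce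
  points, then \<open>v\<^sup>2 \<Phi>' / \<Phi>\<close> extends continuously to the whole closed geodesic, so its derivative
  integrates to 0 and the index form is nonnegative at \<open>v\<close>. Hence evaluation at the \<open>n\<close> bounce
  points is injective on each space where the index form is negative definite; even
  \<open>Ind(\<gamma>) \<le> n\<close> follows.\<close>

text \<open>\<open>smooth_on\<close> speaks of Frechet derivatives; on the line the one in direction
  1 is \<open>deriv\<close>. The two functions agree only on \<open>U\<close>, and openness of
  \<open>U\<close> lets this equality be differentiated at \<open>x\<close>.\<close>

lemma smooth_on_real_derivatives:
  fixes f :: "real \<Rightarrow> real"
  assumes "smooth_on U f" "open U" "x \<in> U"
  shows "(f has_real_derivative deriv f x) (at x)"
    and "(deriv f has_real_derivative deriv (deriv f) x) (at x)"
proof -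
  have "times_differentiable_on (Suc (Suc 0)) U f"
    using assms(1) unfolding smooth_on_def by blast
  then have d1: "\<And>y. y \<in> U \<Longrightarrow> f differentiable (at y)"
    and d2: "(\<lambda>y. frechet_derivative f (at y) 1) differentiable (at x)"
    using assms(3) by auto
  have der: "(f has_real_derivative deriv f y) (at y)" if "y \<in> U" for y
    using d1[OF that] DERIV_deriv_iff_real_differentiable by blast
  then show "(f has_real_derivative deriv f x) (at x)"
    using assms(3) by blast
  have "frechet_derivative f (at y) 1 = deriv f y" if "y \<in> U" for y
    using frechet_derivative_at[OF der[OF that, unfolded has_field_derivative_def]]
    by (metis mult.right_neutral)
  moreover obtain D where "((\<lambda>y. frechet_derivative f (at y) 1) has_real_derivative D) (at x)"
    using d2 real_differentiable_def by blast
  ultimately have "(deriv f has_real_derivative D) (at x)"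
    by (auto intro: has_field_derivative_transform_within_open[OF _ assms(2,3)])
  then show "(deriv f has_real_derivative deriv (deriv f) x) (at x)"
    using DERIV_imp_deriv by blast
qed

lemma periodic_deriv:
  fixes f :: "real \<Rightarrow> real"
  assumes "periodic L f"
  shows "periodic L (deriv f)"
  using assms unfolding periodic_def deriv_def DERIV_shift by simp

lemma periodic_plus_of_int:
  assumes "periodic L f"
  shows "f (t + of_int k * L) = f t"
proof -
  interpret periodic_fun_simple f L
    using assms by unfold_locales (simp add: periodic_def)
  show ?thesis by (rule plus_of_int)
qed

text \<open>Carries continuity from the representatives \<open>s j\<close> in one period to all
  parameters of the bounce points.\<close>

lemma isCont_periodic:
  fixes f :: "real \<Rightarrow> real"
  assumes "periodic L f" "isCont f t"
  shows "isCont f (t + of_int k * L)"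
proof -
  have "isCont (\<lambda>x. f (x + of_int k * L)) t"
    using assms(2) by (simp add: periodic_plus_of_int[OF assms(1)])
  then show ?thesis
    by (simp add: isCont_def LIM_offset_zero_iff[where a = t]
        LIM_offset_zero_iff[where a = "t + of_int k * L"] add_ac)
qed

text \<open>A finite union of translates of the lattice of multiples of \<open>L\<close>. Its
  complement is then open, so \<Phi> has ordinary two-sided derivatives there.\<close>

lemma closed_bounce_params: "closed (bounce_params L n s)"
proof -
  have "bounce_params L n s = (\<Union>j\<in>{1..n}. (+) (s j) ` ((*\<^sub>R) L ` \<int>))"
    unfolding bounce_params_def Ints_def by (fastforce simp: image_image mult.commute)
  then show ?thesis
    by (metis closed_UN closed_Ints closed_scaling closed_translation finite_atLeastAtMost)
qed

text \<open>Provides the finite exceptional set for the fundamental theorem of calculus over one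
  period.\<close>

lemma finite_bounce_params_Int:
  assumes "s ` {1..n} \<subseteq> {0..<L}"
  shows "finite (bounce_params L n s \<inter> {0..L})"
proof (rule finite_subset)
  show "bounce_params L n s \<inter> {0..L} \<subseteq> s ` {1..n} \<union> (\<lambda>j. s j + L) ` {1..n}"
  proof
    fix t assume t: "t \<in> bounce_params L n s \<inter> {0..L}"
    then obtain j k where j: "j \<in> {1..n}" and tk: "t = s j + of_int k * L"
      unfolding bounce_params_def by auto
    have sj: "0 \<le> s j" "s j < L"
      using assms j by (auto simp: image_subset_iff)
    \<comment> \<open>The first bound comes from \<open>0 \<le> t\<close> and
      \<open>s j < L\<close>, the second from \<open>t \<le> L\<close> and
      \<open>0 \<le> s j\<close>. The value \<open>k = 1\<close> occurs only for
      \<open>t = L\<close> and \<open>s j = 0\<close>, where both ends of the interval are the same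
      bounce point.\<close>
    have "0 < (of_int k + 1) * L" "0 \<le> (1 - of_int k) * L"
      using sj t tk unfolding Int_iff atLeastAtMost_iff distrib_right left_diff_distrib by linarith+
    then have "0 < real_of_int k + 1" "0 \<le> 1 - real_of_int k"
      using sj by (simp_all add: zero_less_mult_iff zero_le_mult_iff)
    then have "k = 0 \<or> k = 1"
      by linarith
    then show "t \<in> s ` {1..n} \<union> (\<lambda>j. s j + L) ` {1..n}"
      using j tk by auto
  qed
qed simp

lemma index_form_nonneg:
  assumes bjf: "bouncing_jacobi_field L K n s \<Phi>"
    and per: "periodic L v" and smooth: "smooth_on UNIV v"
    and zero: "\<And>j. j \<in> {1..n} \<Longrightarrow> v (s j) = 0"
  shows "index_form L K v \<ge> 0"
proof -
  define B where "B = bounce_params L n s"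
  have range: "s ` {1..n} \<subseteq> {0..<L}" and per\<Phi>: "periodic L \<Phi>" and cont\<Phi>: "continuous_on UNIV \<Phi>"
    and smooth\<Phi>: "smooth_on (- B) \<Phi>" and n: "n \<ge> 1"
    and jac: "\<And>t. t \<notin> B \<Longrightarrow> deriv (deriv \<Phi>) t = - (K t * \<Phi> t)"
    and gt: "\<And>t. t \<notin> B \<Longrightarrow> \<Phi> t > 1"
    using bjf unfolding bouncing_jacobi_field_def B_def jacobi_operator_def by force+
  have L: "L > 0"
    using range n by fastforce
  \<comment> \<open>The terms of the completed square: \<open>h\<close> is the integrand of the
    index form, \<open>q\<close> the square, and \<open>F\<close> has derivative
    \<open>h - q\<close> off the bounce points.\<close>
  define F where "F t = (v t)\<^sup>2 * deriv \<Phi> t / \<Phi> t" for t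
  define h where "h t = (deriv v t)\<^sup>2 - K t * (v t)\<^sup>2" for t
  define q where "q t = (deriv v t - v t * deriv \<Phi> t / \<Phi> t)\<^sup>2" for t
  have dv: "(v has_real_derivative deriv v t) (at t)" for t
    using smooth_on_real_derivatives(1)[OF smooth] by simp
  have perF: "periodic L F"
    using per per\<Phi> periodic_deriv[OF per\<Phi>] unfolding periodic_def F_def by simp
  have derF: "(F has_real_derivative (h t - q t)) (at t)" if "t \<notin> B" for t
  proof -
    have "open (- B)"
      using closed_bounce_params unfolding B_def by blast
    then have d: "(\<Phi> has_real_derivative deriv \<Phi> t) (at t)"
      "(deriv \<Phi> has_real_derivative - (K t * \<Phi> t)) (at t)"
      using smooth_on_real_derivatives[OF smooth\<Phi>, of t] that by (simp_all add: jac)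
    have "\<Phi> t \<noteq> 0"
      using gt[OF that] by simp
    then show ?thesis
      unfolding F_def h_def q_def
      by (auto intro!: derivative_eq_intros dv d simp: field_simps power2_eq_square)
  qed
  have contF_bounce: "isCont F (s j)" if j: "j \<in> {1..n}" for j
  proof -
    obtain d where d: "(deriv \<Phi> \<longlongrightarrow> d) (at_right (s j))" "(deriv \<Phi> \<longlongrightarrow> - d) (at_left (s j))"
      and one: "\<Phi> (s j) = 1"
      using bjf j unfolding bouncing_jacobi_field_def by blast
    have "(v \<longlongrightarrow> 0) (at (s j))" "(\<Phi> \<longlongrightarrow> 1) (at (s j))"
      using DERIV_isCont[OF dv, of "s j"] cont\<Phi> zero[OF j] one
      by (auto simp: isCont_def continuous_on_eq_continuous_at dest: spec[of _ "s j"])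
    then have lim: "(v \<longlongrightarrow> 0) (at_right (s j))" "(\<Phi> \<longlongrightarrow> 1) (at_right (s j))"
      "(v \<longlongrightarrow> 0) (at_left (s j))" "(\<Phi> \<longlongrightarrow> 1) (at_left (s j))"
      by (auto simp: filterlim_at_split)
    \<comment> \<open>The slope of \<Phi> jumps from \<open>- d\<close> to \<open>d\<close>, but
      both one-sided limits are finite and the factor \<open>(v t)\<^sup>2\<close> tends to
      0.\<close>
    have "(F \<longlongrightarrow> 0\<^sup>2 * d / 1) (at_right (s j))" "(F \<longlongrightarrow> 0\<^sup>2 * (- d) / 1) (at_left (s j))"
      unfolding F_def by (intro tendsto_intros lim d; simp)+
    then have "(F \<longlongrightarrow> 0) (at (s j))"
      by (simp add: filterlim_at_split)
    \<comment> \<open>The value \<open>F (s j)\<close> is 0 because \<open>v (s j) = 0\<close>,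
      whatever \<open>deriv \<Phi>\<close> denotes at the kink.\<close>
    then show ?thesis
      by (simp add: isCont_def F_def zero[OF j])
  qed
  have "isCont F t" for t
  proof (cases "t \<in> B")
    case True
    then obtain j k where "j \<in> {1..n}" "t = s j + of_int k * L"
      unfolding B_def bounce_params_def by auto
    then show ?thesis
      using isCont_periodic[OF perF contF_bounce] by simp
  next
    case False
    then show ?thesis
      using derF DERIV_isCont by blast
  qed
  then have "continuous_on {0..L} F"
    by (simp add: continuous_at_imp_continuous_on)
  \<comment> \<open>Continuity of \<open>F\<close> on the closed interval and a derivative off a
    finite set suffice; this also yields integrability of \<open>h - q\<close>.\<close>
  then have int: "((\<lambda>t. h t - q t) has_integral (F L - F 0)) {0..L}"
    using L derF
    by (intro fundamental_theorem_of_calculus_interior_strong[OF finite_bounce_params_Int[OF range]])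
      (auto simp: B_def has_real_derivative_iff_has_vector_derivative)
  have "F L = F 0"
    using perF unfolding periodic_def by (metis add_0)
  with int have int0: "((\<lambda>t. h t - q t) has_integral 0) {0..L}"
    by simp
  show ?thesis
  \<comment> \<open>If \<open>h\<close> is integrable, then so is \<open>q = h - (h - q)\<close>,
    with the same integral, which is nonnegative. Otherwise \<open>integral\<close> takes its
    default value 0.\<close>
  proof (cases "h integrable_on {0..L}")
    case True
    then have "((\<lambda>t. h t - (h t - q t)) has_integral (integral {0..L} h - 0)) {0..L}"
      by (intro has_integral_diff int0) (simp add: integrable_integral)
    then have "integral {0..L} h - 0 \<ge> 0"
      by (rule has_integral_nonneg) (simp add: q_def)
    then show ?thesis
      unfolding index_form_def h_def by simp
  next
    case False
    then show ?thesis
      unfolding index_form_def h_def by (simp add: not_integrable_integral)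
  qed
qed

text \<open>Restriction to \<open>S\<close> is linear and injective on \<open>V\<close>, and its
  image lies in a space spanned by one indicator function for each point of
  \<open>S\<close>.\<close>

lemma dim_le_card_evaluation:
  fixes S :: "real set"
  assumes sub: "module.subspace scale_fun V" and fin: "finite S"
    and inj: "\<And>v. v \<in> V \<Longrightarrow> (\<forall>p\<in>S. v p = 0) \<Longrightarrow> v = 0"
  shows "vector_space.dim scale_fun V \<le> card S"
proof -
  interpret vector_space scale_fun
    by (rule vector_space_scale_fun)
  interpret pair: vector_space_pair scale_fun scale_fun ..
  \<comment> \<open>Restricted functions are extended by 0, so that \<open>T\<close> maps the space
    of real functions to itself.\<close>
  define T :: "(real \<Rightarrow> real) \<Rightarrow> real \<Rightarrow> real" where "T v t = (if t \<in> S then v t else 0)" for v t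
  define D where "D = (\<lambda>p. indicator {p} :: real \<Rightarrow> real) ` S"
  have lin: "Vector_Spaces.linear scale_fun scale_fun T"
    by unfold_locales (auto simp: T_def algebra_simps fun_eq_iff)
  obtain C where C: "C \<subseteq> V" "independent C" "V \<subseteq> span C" "card C = dim V"
    using basis_exists[of V] by blast
  have "span C \<subseteq> V"
    using C(1) sub by (simp add: span_minimal)
  then have injT: "inj_on T (span C)"
    unfolding pair.linear_inj_on_iff_eq_0[OF lin subspace_span]
    using inj by (metis T_def subsetD zero_fun_apply)
  have "T v \<in> span D" for v
  proof -
    have "(\<Sum>p\<in>S'. f p) t = (\<Sum>p\<in>S'. f p t)" for f :: "real \<Rightarrow> real \<Rightarrow> real" and S' t
      by (induction S' rule: infinite_finite_induct) auto
    then have "T v t = (\<Sum>p\<in>S. scale_fun (v p) (indicator {p})) t" for t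
      using fin by (simp add: T_def indicator_def if_distrib cong: if_cong)
    then have "T v = (\<Sum>p\<in>S. scale_fun (v p) (indicator {p}))"
      by blast
    also have "\<dots> \<in> span D"
      by (intro span_sum span_scale span_base) (simp add: D_def)
    finally show ?thesis .
  qed
  \<comment> \<open>By injectivity \<open>T\<close> sends the basis \<open>C\<close> to an
    independent family, and an independent family in the span of the finite set \<open>D\<close> has
    at most \<open>card D\<close> members.\<close>
  then have "card (T ` C) \<le> card D"
    using independent_span_bound[of D "T ` C"] fin
      pair.linear_independent_injective_image[OF lin C(2) injT]
    by (auto simp: D_def)
  also have "card D \<le> card S"
    unfolding D_def using fin by (rule card_image_le)
  also have "card (T ` C) = card C"
    using injT span_superset by (metis card_image inj_on_subset)
  finally show ?thesis
    using C(4) by simp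
qed

lemma morse_index_le_bounces:
  assumes "bouncing_jacobi_field L K n s \<Phi>"
  shows "morse_index L K \<le> enat n"
  unfolding morse_index_def
proof (rule Sup_least, clarify)
  fix V
  assume sub: "module.subspace scale_fun V"
    and smooth: "\<forall>v\<in>V. periodic L v \<and> smooth_on UNIV v"
    and neg: "\<forall>v\<in>V. v \<noteq> 0 \<longrightarrow> index_form L K v < 0"
  have "vector_space.dim scale_fun V \<le> card (s ` {1..n})"
  proof (rule dim_le_card_evaluation[OF sub])
    fix v assume "v \<in> V" "\<forall>p\<in>s ` {1..n}. v p = 0"
    \<comment> \<open>A nonzero \<open>v\<close> would make the index form both nonnegative and
      negative.\<close>
    then show "v = 0"
      using index_form_nonneg[OF assms, of v] smooth neg by force
  qed simp
  also have "\<dots> \<le> n"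
    using card_image_le[of "{1..n}" s] by simp
  finally show "enat (vector_space.dim scale_fun V) \<le> enat n"
    by simp
qed

theorem corollary5p6:
  fixes M :: "'a topology" and A :: "'a chart set" and g :: "'a metric"
    and L :: real and \<gamma> :: "real \<Rightarrow> 'a"
    and n :: nat and s :: "nat \<Rightarrow> real" and \<Phi> :: "real \<Rightarrow> real"
  assumes "compact_riemannian_surface M A g"
    and "closed_embedded_geodesic M A g L \<gamma>"
    and "bouncing_jacobi_field L (gauss_curvature A g \<circ> \<gamma>) n s \<Phi>"
    and "nondegenerate L (gauss_curvature A g \<circ> \<gamma>) n s \<Phi>"
  shows "enat (2 * n) \<ge> geodesic_index A g L \<gamma>"
proof -
  have "geodesic_index A g L \<gamma> \<le> enat n"
    unfolding geodesic_index_def using assms(3) by (rule morse_index_le_bounces)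
  also have "\<dots> \<le> enat (2 * n)"
    by simp
  finally show ?thesis .
qed

end
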